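(* Let $d\in\mathbb{R}$ with $|d|<1$, and let $\mathcal{P}$ be the one-parameter family (parameter $t\in\mathbb{R}$) of harmonic $N$-gons with vertices $w_1,\dots,w_N$ constructed in the context. For each vertex $w_k$ let $r_k$ be the radius of the generalized Apollonius circle $C_k$, i.e. the circle passing through the points $w_k$, $d$ and $d^{-1}$. Then over $\mathcal{P}$ the sum of inverse squared Apollonius radii is invariant (it does not depend on $t$) and is given by $$\sum_{k=1}^N \frac{1}{r_k^2}=\frac{2N}{(d^{-1}-d)^2}.$$
   Context: Identify $\mathbb{R}^2$ with $\mathbb{C}$ and put $\alpha=\pi/N$, where $N$ is the number of sides of the polygons. Let $C$ be the unit circle centered at the origin. For $t\in\mathbb{R}$ put $z_k=e^{i(2\alpha k+t)}$, $k=1,\dots,N$; these are the vertices of a regular $N$-gon inscribed in $C$. For each $k$ consider the line through $d$ and $z_k$ and let $w_k$ be the other intersection of this line with $C$, i.e. $w_k=\dfrac{d\bar z_k-1}{\bar z_k-d}$. The points $w_1,\dots,w_N$, in the natural order, are the vertices of a harmonic polygon; for fixed $N$ and $d$, the family $\mathcal{P}$ is obtained by varying $t$. *)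

theory Defs
  imports "HOL-Analysis.Analysis"
begin

definition regular_vertex :: "nat \<Rightarrow> real \<Rightarrow> nat \<Rightarrow> complex" where
  "regular_vertex N t k = (let \<alpha> = pi / real N in exp (\<i> * complex_of_real (2 * \<alpha> * real k + t)))"

definition harmonic_vertex :: "nat \<Rightarrow> real \<Rightarrow> real \<Rightarrow> nat \<Rightarrow> complex" where
  "harmonic_vertex N d t k =
     (let z = regular_vertex N t k in (of_real d * cnj z - 1) / (cnj z - of_real d))"

(* The formula does give the second intersection with the unit circle of the line through d and z:
   the point lies on the circle and on the line, strictly on the other side of d. *)

lemma harmonic_vertex_second_intersection:
  fixes d t :: real
  assumes "\<bar>d\<bar> < 1"
  shows "harmonic_vertex N d t k \<in> sphere 0 1"
    and "\<exists>s>0. harmonic_vertex N d t k - of_real d = - (of_real s * (regular_vertex N t k - of_real d))"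
proof -
  define z where "z = regular_vertex N t k"
  have z1: "cmod z = 1"
    by (simp add: z_def regular_vertex_def Let_def del: of_real_add of_real_mult)
  have zz: "z * cnj z = 1"
    using z1 by (simp add: complex_norm_square [symmetric])
  have ne: "z \<noteq> of_real d" using z1 assms by auto
  hence ne': "cnj z \<noteq> of_real d" by (metis complex_cnj_cnj complex_cnj_complex_of_real)
  have w: "harmonic_vertex N d t k = (of_real d * cnj z - 1) / (cnj z - of_real d)"
    by (simp add: harmonic_vertex_def z_def Let_def)
  have "of_real d * cnj z - 1 = cnj z * (of_real d - z)"
    using zz by (simp add: algebra_simps)
  hence "cmod (of_real d * cnj z - 1) = cmod (of_real d - z)"
    using z1 by (simp add: norm_mult)
  also have "\<dots> = cmod (cnj z - of_real d)"
    by (metis complex_cnj_complex_of_real complex_cnj_diff complex_mod_cnj norm_minus_commute)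
  finally show "harmonic_vertex N d t k \<in> sphere 0 1"
    using ne' by (simp add: w norm_divide)
  define s where "s = (1 - d\<^sup>2) / (cmod (z - of_real d))\<^sup>2"
  have "d\<^sup>2 < 1" using assms by (simp add: abs_square_less_1)
  hence "s > 0" using ne by (simp add: s_def)
  have n2: "of_real ((cmod (z - of_real d))\<^sup>2) = (z - of_real d) * (cnj z - of_real d)"
    by (simp only: complex_norm_square complex_cnj_diff complex_cnj_complex_of_real)
  have cancel: "u / (p * q) * p = u / q" if "p \<noteq> 0" for u p q :: complex
    using that by simp
  have "harmonic_vertex N d t k - of_real d = - (of_real (1 - d\<^sup>2) / (cnj z - of_real d))"
    using ne' by (simp add: w field_simps power2_eq_square)
  also have "\<dots> = - (of_real s * (z - of_real d))"
    unfolding s_def of_real_divide n2 using cancel ne by simp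
  finally show "\<exists>s>0. harmonic_vertex N d t k - of_real d = - (of_real s * (regular_vertex N t k - of_real d))"
    using \<open>s > 0\<close> unfolding z_def by blast
qed

(* A circle through three collinear points is understood in the generalized sense: it is a line,
   with infinite radius. *)

definition circle_radius :: "complex \<Rightarrow> complex \<Rightarrow> complex \<Rightarrow> ereal" where
  "circle_radius a b c =
     (if collinear {a, b, c} then \<infinity>
      else ereal (THE r. \<exists>m. {a, b, c} \<subseteq> sphere m r))"

(* For d = 0 the point 1/d is the point at infinity, and the generalized circle through w, 0 and
   infinity is the line through w and 0. *)

definition apollonius_radius :: "real \<Rightarrow> complex \<Rightarrow> ereal" where
  "apollonius_radius d w =
     (if d = 0 then \<infinity> else circle_radius w (of_real d) (of_real (inverse d)))"

lemma circle_through_unique: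
  fixes a b c :: complex
  assumes "\<not> collinear {a, b, c}"
  shows "\<exists>!r. \<exists>m. {a, b, c} \<subseteq> sphere m r"
proof -
  define x1 y1 x2 y2 where
    defs: "x1 = Re (b - a)" "y1 = Im (b - a)" "x2 = Re (c - a)" "y2 = Im (c - a)"
  define D where "D = x1 * y2 - x2 * y1"
  have D: "D \<noteq> 0"
  proof
    assume D0: "D = 0"
    have ba: "b \<noteq> a" using assms by auto
    hence n0: "x1\<^sup>2 + y1\<^sup>2 \<noteq> 0"
      by (auto simp: defs complex_eq_iff sum_power2_eq_zero_iff)
    define u where "u = (x1 * x2 + y1 * y2) / (x1\<^sup>2 + y1\<^sup>2)"
    have "x2 * (x1\<^sup>2 + y1\<^sup>2) = (x1 * x2 + y1 * y2) * x1"
         "y2 * (x1\<^sup>2 + y1\<^sup>2) = (x1 * x2 + y1 * y2) * y1"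
      using D0 unfolding D_def by algebra+
    hence "x2 = u * x1" "y2 = u * y1"
      using n0 by (simp_all add: u_def field_simps)
    hence "c - a = u *\<^sub>R (b - a)"
      by (simp add: complex_eq_iff defs)
    hence "collinear {0, b - a, c - a}"
      by (auto simp: collinear_lemma)
    hence "collinear {b, a, c}" by (simp add: collinear_3)
    thus False using assms by (simp add: insert_commute)
  qed
  define h k where "h = (y2 * (x1\<^sup>2 + y1\<^sup>2) - y1 * (x2\<^sup>2 + y2\<^sup>2)) / (2 * D)"
    and "k = (x1 * (x2\<^sup>2 + y2\<^sup>2) - x2 * (x1\<^sup>2 + y1\<^sup>2)) / (2 * D)"
  have sphere_iff: "{a, b, c} \<subseteq> sphere m r \<longleftrightarrow> m = a + Complex h k \<and> r = cmod (Complex h k)" for m r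
  proof -
    define p q where "p = Re (m - a)" and "q = Im (m - a)"
    have "{a, b, c} \<subseteq> sphere m r \<longleftrightarrow>
        r = sqrt (p\<^sup>2 + q\<^sup>2) \<and> dist m b = dist m a \<and> dist m c = dist m a"
      by (auto simp: dist_norm cmod_def p_def q_def)
    also have "dist m b = dist m a \<longleftrightarrow> 2 * (p * x1 + q * y1) = x1\<^sup>2 + y1\<^sup>2"
      unfolding dist_norm cmod_def real_sqrt_eq_iff
      by (auto simp: p_def q_def defs power2_eq_square algebra_simps)
    also have "dist m c = dist m a \<longleftrightarrow> 2 * (p * x2 + q * y2) = x2\<^sup>2 + y2\<^sup>2"
      unfolding dist_norm cmod_def real_sqrt_eq_iff
      by (auto simp: p_def q_def defs power2_eq_square algebra_simps)
    also have "2 * (p * x1 + q * y1) = x1\<^sup>2 + y1\<^sup>2 \<and> 2 * (p * x2 + q * y2) = x2\<^sup>2 + y2\<^sup>2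
        \<longleftrightarrow> p = h \<and> q = k"
    proof
      assume *: "2 * (p * x1 + q * y1) = x1\<^sup>2 + y1\<^sup>2 \<and> 2 * (p * x2 + q * y2) = x2\<^sup>2 + y2\<^sup>2"
      have "p * (2 * D) = y2 * (x1\<^sup>2 + y1\<^sup>2) - y1 * (x2\<^sup>2 + y2\<^sup>2)"
           "q * (2 * D) = x1 * (x2\<^sup>2 + y2\<^sup>2) - x2 * (x1\<^sup>2 + y1\<^sup>2)"
        using * unfolding D_def by algebra+
      thus "p = h \<and> q = k" using D by (simp add: h_def k_def field_simps)
    next
      assume *: "p = h \<and> q = k"
      have "p * (2 * D) = y2 * (x1\<^sup>2 + y1\<^sup>2) - y1 * (x2\<^sup>2 + y2\<^sup>2)"
           "q * (2 * D) = x1 * (x2\<^sup>2 + y2\<^sup>2) - x2 * (x1\<^sup>2 + y1\<^sup>2)"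
        using * D by (simp_all add: h_def k_def)
      hence "D * (2 * (p * x1 + q * y1)) = D * (x1\<^sup>2 + y1\<^sup>2)"
            "D * (2 * (p * x2 + q * y2)) = D * (x2\<^sup>2 + y2\<^sup>2)"
        unfolding D_def by algebra+
      thus "2 * (p * x1 + q * y1) = x1\<^sup>2 + y1\<^sup>2 \<and> 2 * (p * x2 + q * y2) = x2\<^sup>2 + y2\<^sup>2"
        using D by simp
    qed
    finally show ?thesis
      by (auto simp: p_def q_def complex_eq_iff cmod_def)
  qed
  show ?thesis unfolding sphere_iff by blast
qed

end

theory Submission
  imports Defs
begin

text \<open>Write \<open>z = x + i y\<close> for a vertex of the regular polygon and \<open>w\<close> for the corresponding
  harmonic vertex. The circle through \<open>w\<close>, \<open>d\<close> and \<open>1/d\<close> is orthogonal to the unit circle, which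
  determines its centre as \<open>(d + 1/d)/2 - i (1 - d\<^sup>2) x / (2 d y)\<close>. Hence its curvature is
  \<open>2 |y| / |1/d - d|\<close>, also when \<open>y = 0\<close> and the circle degenerates to the real line. So the sum of
  squared curvatures is a multiple of the sum of \<open>y\<^sup>2 = (1 - Re (z\<^sup>2)) / 2\<close>, and the sum of the \<open>z\<^sup>2\<close>
  vanishes for \<open>N \<ge> 3\<close>.\<close>

lemma circle_radius_eqI:
  assumes "\<not> collinear {a, b, c}" "{a, b, c} \<subseteq> sphere m r"
  shows "circle_radius a b c = ereal r"
proof -
  have "(THE r. \<exists>m. {a, b, c} \<subseteq> sphere m r) = r"
    by (rule the1_equality [OF circle_through_unique [OF assms(1)]]) (use assms(2) in blast)
  thus ?thesis using assms(1) by (simp add: circle_radius_def)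
qed

text \<open>Two distinct real points span the real axis. This separates the degenerate vertices,
  whose circle is that axis, from the others.\<close>

lemma collinear_of_real_iff:
  assumes "p \<noteq> q"
  shows "collinear {w, complex_of_real p, complex_of_real q} \<longleftrightarrow> Im w = 0"
proof -
  have "collinear {w, complex_of_real p, complex_of_real q} \<longleftrightarrow>
      collinear {complex_of_real q, complex_of_real p, w}"
    by (simp add: insert_commute)
  also have "\<dots> \<longleftrightarrow> collinear {0, complex_of_real (q - p), w - of_real p}"
    by (simp add: collinear_3)
  also have "\<dots> \<longleftrightarrow> (w - of_real p) / complex_of_real (q - p) \<in> \<real>"
    by (rule collinear_iff_Reals)
  also have "\<dots> \<longleftrightarrow> Im w = 0"
    using assms by (simp add: complex_is_Real_iff Im_divide_of_real del: of_real_diff)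
  finally show ?thesis .
qed

lemma norm_regular_vertex: "cmod (regular_vertex N t k) = 1"
  by (simp add: regular_vertex_def Let_def del: of_real_add of_real_mult)

text \<open>Since \<open>z\<close> is on the unit circle, \<open>q\<close> is the squared distance
  from \<open>z\<close> to \<open>d\<close>, that is, the real denominator obtained by expanding the
  quotient with the conjugate of \<open>cnj z - d\<close>.\<close>

lemma harmonic_vertex_coords:
  fixes d t :: real and N k :: nat
  assumes "\<bar>d\<bar> < 1"
  defines "z \<equiv> regular_vertex N t k"
  defines "q \<equiv> 1 - 2 * d * Re z + d\<^sup>2"
  shows "q > 0"
    and "Re (harmonic_vertex N d t k) = (2 * d - (1 + d\<^sup>2) * Re z) / q"
    and "Im (harmonic_vertex N d t k) = - ((1 - d\<^sup>2) * Im z) / q"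
proof -
  have z1: "(Re z)\<^sup>2 + (Im z)\<^sup>2 = 1"
    using norm_regular_vertex [of N t k] by (simp add: z_def cmod_def)
  have q: "q = (Re z - d)\<^sup>2 + (Im z)\<^sup>2"
    using z1 unfolding q_def by algebra
  have "z \<noteq> of_real d" using norm_regular_vertex [of N t k] assms by (auto simp: z_def)
  thus "q > 0" unfolding q by (auto simp: complex_eq_iff sum_power2_gt_zero_iff)
  have re: "(d * Re z - 1) * (Re z - d) + d * (Im z)\<^sup>2 = 2 * d - (1 + d\<^sup>2) * Re z"
    using z1 by algebra
  have im: "(d * Re z - 1) * Im z - d * Im z * (Re z - d) = - ((1 - d\<^sup>2) * Im z)"
    by algebra
  have w: "harmonic_vertex N d t k = (of_real d * cnj z - 1) / (cnj z - of_real d)"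
    by (simp add: harmonic_vertex_def z_def Let_def)
  show "Re (harmonic_vertex N d t k) = (2 * d - (1 + d\<^sup>2) * Re z) / q"
    unfolding w Re_divide using re by (simp add: q power2_eq_square)
  show "Im (harmonic_vertex N d t k) = - ((1 - d\<^sup>2) * Im z) / q"
    unfolding w Im_divide using im by (simp add: q algebra_simps)
qed

text \<open>Centre and radius are exhibited and checked at the three points; uniqueness of the
  circle then identifies the radius.\<close>

lemma inverse_apollonius_radius_squared:
  fixes d t :: real and N k :: nat
  assumes "\<bar>d\<bar> < 1" "d \<noteq> 0"
  defines "z \<equiv> regular_vertex N t k"
  shows "1 / (apollonius_radius d (harmonic_vertex N d t k))\<^sup>2
           = ereal (4 * (Im z)\<^sup>2 / (inverse d - d)\<^sup>2)"
proof -
  define w where "w = harmonic_vertex N d t k"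
  define x y where "x = Re z" and "y = Im z"
  define q where "q = 1 - 2 * d * x + d\<^sup>2"
  have xy: "x\<^sup>2 + y\<^sup>2 = 1"
    using norm_regular_vertex [of N t k] by (simp add: z_def x_def y_def cmod_def)
  have d2: "1 - d\<^sup>2 > 0" using assms by (simp add: abs_square_less_1)
  have ne: "d \<noteq> inverse d"
    using d2 assms(2) by (auto simp: field_simps power2_eq_square)
  have q: "q > 0" and Re_w: "Re w = (2 * d - (1 + d\<^sup>2) * x) / q"
    and Im_w: "Im w = - ((1 - d\<^sup>2) * y) / q"
    using harmonic_vertex_coords [OF assms(1), where t = t and N = N and k = k]
    by (simp_all add: w_def q_def x_def y_def z_def)
  have ap: "apollonius_radius d w = circle_radius w (of_real d) (of_real (inverse d))"
    using assms(2) by (simp add: apollonius_radius_def)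
  show ?thesis
  proof (cases "y = 0")
    case True
    hence "Im w = 0" by (simp add: Im_w)
    hence "apollonius_radius d w = \<infinity>"
      unfolding ap circle_radius_def by (subst collinear_of_real_iff [OF ne]) simp
    \<comment> \<open>In \<open>ereal\<close>, 1 divided by \<infinity> is 0, which agrees with the
      right-hand side at \<open>Im z = 0\<close>.\<close>
    thus ?thesis using True by (simp add: w_def y_def power2_eq_square zero_ereal_def)
  next
    case y: False
    have nc: "\<not> collinear {w, of_real d, of_real (inverse d)}"
      using y d2 q by (subst collinear_of_real_iff [OF ne]) (simp add: Im_w)
    \<comment> \<open>Half the distance between \<open>d\<close> and \<open>inverse d\<close>,
      divided by \<open>\<bar>y\<bar>\<close>.\<close>
    define r where "r = (1 - d\<^sup>2) / (2 * \<bar>d\<bar> * \<bar>y\<bar>)"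
    \<comment> \<open>\<open>h\<close> is the midpoint of \<open>d\<close> and
      \<open>inverse d\<close>; \<open>Y\<close> solves \<open>h * Re w + Y * Im w = 1\<close>,
      which puts the centre on the tangent to the unit circle at \<open>w\<close>.\<close>
    define h Y where "h = (1 + d\<^sup>2) / (2 * d)" and "Y = - ((1 - d\<^sup>2) * x) / (2 * d * y)"
    have r: "r > 0" using d2 y assms(2) by (simp add: r_def)
    have r2: "r\<^sup>2 = (1 - d\<^sup>2)\<^sup>2 / (4 * d\<^sup>2 * y\<^sup>2)"
      by (simp add: r_def power_divide power_mult_distrib)
    have dY: "(h - d)\<^sup>2 + Y\<^sup>2 = r\<^sup>2" "(h - inverse d)\<^sup>2 + Y\<^sup>2 = r\<^sup>2"
    proof -
      have "(h - d)\<^sup>2 = (1 - d\<^sup>2)\<^sup>2 / (4 * d\<^sup>2)" "(h - inverse d)\<^sup>2 = (1 - d\<^sup>2)\<^sup>2 / (4 * d\<^sup>2)"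
        using assms(2) by (simp_all add: h_def field_simps power2_eq_square)
      moreover have "(1 - d\<^sup>2)\<^sup>2 / (4 * d\<^sup>2) + Y\<^sup>2 = (1 - d\<^sup>2)\<^sup>2 * (x\<^sup>2 + y\<^sup>2) / (4 * d\<^sup>2 * y\<^sup>2)"
        using y assms(2) by (simp add: Y_def power_divide power_mult_distrib field_simps) algebra
      ultimately show "(h - d)\<^sup>2 + Y\<^sup>2 = r\<^sup>2" "(h - inverse d)\<^sup>2 + Y\<^sup>2 = r\<^sup>2"
        by (simp_all add: r2 xy)
    qed
    have "(h - Re w)\<^sup>2 + (Y - Im w)\<^sup>2 = r\<^sup>2"
    proof -
      have hw: "h - Re w = (1 - d\<^sup>2)\<^sup>2 / (2 * d * q)"
      proof -
        have "(1 + d\<^sup>2) * q - 2 * d * (2 * d - (1 + d\<^sup>2) * x) = (1 - d\<^sup>2)\<^sup>2"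
          unfolding q_def by algebra
        moreover have "h - Re w = ((1 + d\<^sup>2) * q - 2 * d * (2 * d - (1 + d\<^sup>2) * x)) / (2 * d * q)"
          unfolding h_def Re_w using q assms(2) by (simp add: diff_frac_eq)
        ultimately show ?thesis by simp
      qed
      have Yw: "Y - Im w = (1 - d\<^sup>2) * (2 * d * y\<^sup>2 - x * q) / (2 * d * y * q)"
        unfolding Y_def Im_w using q assms(2) y by (simp add: field_simps power2_eq_square)
      have "(h - Re w)\<^sup>2 + (Y - Im w)\<^sup>2
          = (1 - d\<^sup>2)\<^sup>2 * ((1 - d\<^sup>2)\<^sup>2 * y\<^sup>2 + (2 * d * y\<^sup>2 - x * q)\<^sup>2) / (4 * d\<^sup>2 * y\<^sup>2 * q\<^sup>2)"
        unfolding hw Yw using q assms(2) y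
        by (simp add: power_divide power_mult_distrib divide_simps) algebra
      \<comment> \<open>As \<open>2 * d * y\<^sup>2 - x * q = q * Re w\<close> and
        \<open>(1 - d\<^sup>2) * y = - q * Im w\<close>, this is the equation of the unit circle at
        \<open>w\<close>, scaled by \<open>q\<^sup>2\<close>.\<close>
      also have "(1 - d\<^sup>2)\<^sup>2 * y\<^sup>2 + (2 * d * y\<^sup>2 - x * q)\<^sup>2 = q\<^sup>2"
        using xy unfolding q_def by algebra
      finally show ?thesis using q by (simp add: r2)
    qed
    hence "{w, of_real d, of_real (inverse d)} \<subseteq> sphere (Complex h Y) r"
      using dY r by (simp add: dist_norm cmod_def del: of_real_inverse)
    hence "apollonius_radius d w = ereal r"
      unfolding ap using nc by (rule circle_radius_eqI [rotated])
    moreover have "1 / r\<^sup>2 = 4 * y\<^sup>2 / (inverse d - d)\<^sup>2"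
    proof -
      have "inverse d - d = (1 - d\<^sup>2) / d"
        using assms(2) by (simp add: field_simps power2_eq_square)
      thus ?thesis by (simp add: r2 power_divide)
    qed
    ultimately show ?thesis
      using r by (simp add: w_def y_def one_ereal_def)
  qed
qed

text \<open>The squares form a geometric progression whose ratio \<open>\<omega>\<close> is an
  \<open>N\<close>-th root of unity, different from 1 because \<open>N\<close> does not divide 2.
  The parameter \<open>t\<close> enters only through the common factor
  \<open>cis (2 * t)\<close>.\<close>

lemma sum_regular_vertex_squared:
  assumes "N \<ge> 3"
  shows "(\<Sum>k=1..N. (regular_vertex N t k)\<^sup>2) = 0"
proof -
  define \<omega> where "\<omega> = cis (4 * pi / real N)"
  have sq: "(regular_vertex N t k)\<^sup>2 = cis (2 * t) * \<omega> ^ k" for k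
  proof -
    have "regular_vertex N t k = cis (2 * (pi / real N) * real k + t)"
      unfolding regular_vertex_def Let_def cis_conv_exp ..
    thus ?thesis
      by (simp add: \<omega>_def Complex.DeMoivre cis_mult algebra_simps)
  qed
  have "\<omega> ^ N = cis (2 * pi * of_int 2)"
    using assms by (simp add: \<omega>_def Complex.DeMoivre)
  hence \<omega>N: "\<omega> ^ N = 1" by (subst (asm) cis_multiple_2pi) auto
  have "\<omega> \<noteq> 1"
  proof
    assume "\<omega> = 1"
    hence "cos (4 * pi / real N) = 1" by (simp add: \<omega>_def complex_eq_iff)
    then obtain n :: int where n: "4 * pi / real N = of_int n * 2 * pi"
      unfolding cos_one_2pi_int by blast
    hence "2 = real_of_int n * real N" using assms by (simp add: field_simps)
    hence "2 = n * int N"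
      by (metis of_int_eq_iff of_int_mult of_int_numeral of_int_of_nat_eq)
    hence "int N dvd 2" by (metis dvd_triv_right)
    thus False using assms zdvd_imp_le by fastforce
  qed
  \<comment> \<open>The exponents start at 1; factoring out one \<open>\<omega>\<close> gives the
    standard geometric sum.\<close>
  have "(\<Sum>k=1..N. \<omega> ^ k) = \<omega> * (\<Sum>k<N. \<omega> ^ k)"
    by (simp add: sum_distrib_left lessThan_atLeast0 sum.shift_bounds_Suc_ivl [symmetric]
        atLeastLessThanSuc_atLeastAtMost flip: power_Suc)
  also have "\<dots> = 0" using \<open>\<omega> \<noteq> 1\<close> \<omega>N by (simp add: geometric_sum)
  finally show ?thesis by (simp add: sq flip: sum_distrib_left)
qed

lemma sum_Im_regular_vertex_squared:
  assumes "N \<ge> 3"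
  shows "(\<Sum>k=1..N. (Im (regular_vertex N t k))\<^sup>2) = real N / 2"
proof -
  have "(Im (regular_vertex N t k))\<^sup>2 = (1 - Re ((regular_vertex N t k)\<^sup>2)) / 2" for k
    using norm_regular_vertex [of N t k] by (simp add: cmod_def power2_eq_square)
  hence "(\<Sum>k=1..N. (Im (regular_vertex N t k))\<^sup>2)
      = (\<Sum>k=1..N. (1 - Re ((regular_vertex N t k)\<^sup>2)) / 2)"
    by (simp only:)
  also have "\<dots> = (real N - Re (\<Sum>k=1..N. (regular_vertex N t k)\<^sup>2)) / 2"
    by (simp add: sum_subtractf flip: sum_divide_distrib)
  finally show ?thesis by (simp add: sum_regular_vertex_squared [OF assms] del: One_nat_def)
qed

theorem proposition2:
  fixes N :: nat and d :: real
  assumes "N \<ge> 3" and "\<bar>d\<bar> < 1"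
  shows "\<forall>t::real. (\<Sum>k=1..N. 1 / (apollonius_radius d (harmonic_vertex N d t k))\<^sup>2)
           = ereal (2 * real N) / (inverse (ereal d) - ereal d)\<^sup>2"
proof (cases "d = 0")
  case True
  \<comment> \<open>All radii are infinite, so the left side is 0; on the right
    \<open>inverse (ereal 0)\<close> is \<infinity>, so that quotient is 0 too.\<close>
  thus ?thesis by (simp add: apollonius_radius_def power2_eq_square)
next
  case False
  have "d\<^sup>2 < 1" using assms(2) by (simp add: abs_square_less_1)
  \<comment> \<open>A nonzero denominator makes division in \<open>ereal\<close> agree with real
    division.\<close>
  hence ne: "inverse d - d \<noteq> 0"
    using False by (auto simp: field_simps power2_eq_square)
  show ?thesis
  proof
    fix t
    have "(\<Sum>k=1..N. 1 / (apollonius_radius d (harmonic_vertex N d t k))\<^sup>2)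
        = ereal (4 * (\<Sum>k=1..N. (Im (regular_vertex N t k))\<^sup>2) / (inverse d - d)\<^sup>2)"
      by (simp add: inverse_apollonius_radius_squared [OF assms(2) False]
          sum_distrib_left sum_divide_distrib)
    also have "\<dots> = ereal (2 * real N / (inverse d - d)\<^sup>2)"
      by (simp add: sum_Im_regular_vertex_squared [OF assms(1)] del: One_nat_def)
    also have "\<dots> = ereal (2 * real N) / (inverse (ereal d) - ereal d)\<^sup>2"
      using False ne by simp
    finally show "(\<Sum>k=1..N. 1 / (apollonius_radius d (harmonic_vertex N d t k))\<^sup>2)
        = ereal (2 * real N) / (inverse (ereal d) - ereal d)\<^sup>2" .
  qed
qed

end
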